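(* For every $n\ge0$, $$|\mathcal{RS}_n(213,231)|=F_{n+1},$$ where $F_m$ denotes the $m$-th Fibonacci number.
   Context: $\mathfrak{S}_n$ is the set of permutations of $\{1,\dots,n\}$, written in one-line notation $\pi=\pi_1\pi_2\dots\pi_n$ ($\mathfrak{S}_0$ consists of the empty permutation). A permutation $\pi\in\mathfrak{S}_n$ is simsun if for every $3\le k\le n$, the subword of $\pi_1\pi_2\dots\pi_n$ consisting of the entries in $\{1,\dots,k\}$ (kept in their order) has no double descent, i.e. no three entries that are consecutive in that subword and in decreasing order. A permutation $\pi\in\mathfrak{S}_n$ avoids the pattern $\sigma\in\mathfrak{S}_k$ if there are no indices $i_1<i_2<\dots<i_k$ such that $\pi_{i_1}\pi_{i_2}\dots\pi_{i_k}$ is in the same relative order as $\sigma$. $\mathcal{RS}_n(\sigma,\tau)$ is the set of simsun permutations in $\mathfrak{S}_n$ avoiding both $\sigma$ and $\tau$. The Fibonacci numbers are given by $\sum_{n\ge0}F_nz^n=\frac{z}{1-z-z^2}$, i.e. $F_0=0$, $F_1=1$, $F_{n+2}=F_{n+1}+F_n$. *)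

theory Defs
  imports "HOL-Combinatorics.Multiset_Permutations" "HOL-Number_Theory.Fib"
begin

(* A permutation of {1..n} is represented by its one-line notation, i.e. as an element of
   permutations_of_set {1..n}; list positions are counted from 0. *)

definition double_descent :: "nat list \<Rightarrow> bool" where
  "double_descent w \<longleftrightarrow>
     (\<exists>i. i + 2 < length w \<and> w ! i > w ! (i + 1) \<and> w ! (i + 1) > w ! (i + 2))"

definition simsun :: "nat list \<Rightarrow> bool" where
  "simsun p \<longleftrightarrow> (\<forall>k. 3 \<le> k \<and> k \<le> length p \<longrightarrow> \<not> double_descent (filter (\<lambda>x. x \<in> {1..k}) p))"

(* The function i picks out the positions of an occurrence of the pattern s in p. *)
definition contains_pattern :: "nat list \<Rightarrow> nat list \<Rightarrow> bool" where
  "contains_pattern p s \<longleftrightarrow>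
     (\<exists>i :: nat \<Rightarrow> nat. strict_mono_on {..<length s} i \<and> i ` {..<length s} \<subseteq> {..<length p} \<and>
        (\<forall>a<length s. \<forall>b<length s. p ! i a < p ! i b \<longleftrightarrow> s ! a < s ! b))"

definition RS :: "nat \<Rightarrow> nat list \<Rightarrow> nat list \<Rightarrow> nat list set" where
  "RS n s t = {p \<in> permutations_of_set {1..n}.
     simsun p \<and> \<not> contains_pattern p s \<and> \<not> contains_pattern p t}"

end

theory Submission
  imports Defs
begin

text \<open>
  A word avoids both 213 and 231 exactly when no entry has both a smaller and a larger entry to
  its right, since an entry with both is the letter 2 of one of the two patterns. So each entry is
  the minimum or the maximum of the suffix that it starts. Suppose that such a word is simsun and
  uses at least two letters. If it starts with its minimum, then the rest is an arbitrary word of the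
  same kind, because a minimal first letter never takes part in a descent. If it starts with
  its maximum, then the second letter must be the minimum of what is left: a second
  maximum would begin a double descent with the first. After these two letters the rest is again
  arbitrary, since the minimum in second position separates it from the descent in front.
  This is the recurrence of the Fibonacci numbers (\<open>card_extremal_simsun\<close>).

  The argument removes letters other than the largest, so it is carried out for words over an
  arbitrary finite alphabet rather than for permutations of an initial segment; \<open>RS_eq\<close> links
  the two settings.
\<close>

section \<open>Words whose entries are extremal in their suffixes\<close>

primrec extremal :: "'a::linorder list \<Rightarrow> bool" where
  "extremal [] \<longleftrightarrow> True"
| "extremal (x # w) \<longleftrightarrow> \<not> (\<exists>y\<in>set w. \<exists>z\<in>set w. y < x \<and> x < z) \<and> extremal w"

lemma extremal_iff_nth:
  "extremal w \<longleftrightarrow>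
     (\<nexists>i j k. i < j \<and> i < k \<and> j < length w \<and> k < length w \<and> w ! j < w ! i \<and> w ! i < w ! k)"
proof (induction w)
  case Nil
  then show ?case by simp
next
  case (Cons x w)
  have head: "(\<exists>y\<in>set w. \<exists>z\<in>set w. y < x \<and> x < z) \<longleftrightarrow>
      (\<exists>j k. j < length w \<and> k < length w \<and> w ! j < x \<and> x < w ! k)"
    by (metis in_set_conv_nth)
  have "(\<exists>i j k. i < j \<and> i < k \<and> j < length (x # w) \<and> k < length (x # w) \<and>
          (x # w) ! j < (x # w) ! i \<and> (x # w) ! i < (x # w) ! k) \<longleftrightarrow>
      (\<exists>j k. j < length w \<and> k < length w \<and> w ! j < x \<and> x < w ! k) \<or>
      (\<exists>i j k. i < j \<and> i < k \<and> j < length w \<and> k < length w \<and> w ! j < w ! i \<and> w ! i < w ! k)"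
    (is "?L \<longleftrightarrow> ?H \<or> ?T")
  proof
    assume ?L
    then obtain i j k where ijk: "i < j" "i < k" "j < length (x # w)" "k < length (x # w)"
      "(x # w) ! j < (x # w) ! i" "(x # w) ! i < (x # w) ! k" by blast
    obtain j' k' where "j = Suc j'" "k = Suc k'"
      using ijk(1,2) by (metis less_nat_zero_code not0_implies_Suc)
    with ijk show "?H \<or> ?T" by (cases i) auto
  next
    assume "?H \<or> ?T"
    then show ?L
    proof
      assume ?H
      then obtain j k where "j < length w" "k < length w" "w ! j < x" "x < w ! k" by blast
      then show ?L by (intro exI[of _ 0] exI[of _ "Suc j"] exI[of _ "Suc k"]) auto
    next
      assume ?T
      then obtain i j k where "i < j" "i < k" "j < length w" "k < length w"
        "w ! j < w ! i" "w ! i < w ! k" by blast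
      then show ?L by (intro exI[of _ "Suc i"] exI[of _ "Suc j"] exI[of _ "Suc k"]) auto
    qed
  qed
  then show ?case using Cons.IH head by (simp only: extremal.simps) blast
qed

lemma all_less_3: "(\<forall>r<3::nat. P r) \<longleftrightarrow> P 0 \<and> P 1 \<and> P 2"
  by (auto simp: numeral_3_eq_3 numeral_2_eq_2 less_Suc_eq)

lemma contains_pattern_3_iff:
  "contains_pattern p [a, b, c] \<longleftrightarrow>
     (\<exists>i j k. i < j \<and> j < k \<and> k < length p \<and>
        (\<forall>r<3. \<forall>s<3. p ! ([i, j, k] ! r) < p ! ([i, j, k] ! s) \<longleftrightarrow> [a, b, c] ! r < [a, b, c] ! s))"
    (is "_ \<longleftrightarrow> ?R")
proof
  assume "contains_pattern p [a, b, c]"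
  then obtain f :: "nat \<Rightarrow> nat" where f: "strict_mono_on {..<3} f" "f ` {..<3} \<subseteq> {..<length p}"
    "\<forall>r<3. \<forall>s<3. p ! f r < p ! f s \<longleftrightarrow> [a, b, c] ! r < [a, b, c] ! s"
    unfolding contains_pattern_def by (auto simp: numeral_3_eq_3)
  have "f 0 < f 1" "f 1 < f 2" using f(1) by (auto simp: strict_mono_on_def)
  moreover have "f 2 < length p" using f(2) by (simp add: image_subset_iff)
  moreover have "[f 0, f 1, f 2] ! r = f r" if "r < 3" for r
    using that by (auto simp: less_Suc_eq numeral_3_eq_3 numeral_2_eq_2)
  ultimately show ?R using f(3)
    by (intro exI[of _ "f 0"] exI[of _ "f 1"] exI[of _ "f 2"]) simp
next
  assume ?R
  then obtain i j k where ijk: "i < j" "j < k" "k < length p"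
    "\<forall>r<3. \<forall>s<3. p ! ([i, j, k] ! r) < p ! ([i, j, k] ! s) \<longleftrightarrow> [a, b, c] ! r < [a, b, c] ! s"
    by blast
  have "strict_mono_on {..<3} ((!) [i, j, k])"
    using ijk(1,2) by (auto simp: strict_mono_on_def less_Suc_eq numeral_3_eq_3)
  moreover have "(!) [i, j, k] ` {..<3} \<subseteq> {..<length p}"
    using ijk(1-3) by (auto simp: less_Suc_eq numeral_3_eq_3)
  ultimately show "contains_pattern p [a, b, c]"
    unfolding contains_pattern_def using ijk(4)
    by (intro exI[of _ "(!) [i, j, k]"]) (simp add: numeral_3_eq_3)
qed

lemma contains_213_iff:
  "contains_pattern p [2, 1, 3] \<longleftrightarrow>
     (\<exists>i j k. i < j \<and> j < k \<and> k < length p \<and> p ! j < p ! i \<and> p ! i < p ! k)"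
proof -
  have "(\<forall>r<3. \<forall>s<3. p ! ([i, j, k] ! r) < p ! ([i, j, k] ! s) \<longleftrightarrow>
          [2, 1, 3 :: nat] ! r < [2, 1, 3] ! s) \<longleftrightarrow> p ! j < p ! i \<and> p ! i < p ! k" for i j k
    by (auto simp: all_less_3 dest: order.asym)
  then show ?thesis by (simp add: contains_pattern_3_iff)
qed

lemma contains_231_iff:
  "contains_pattern p [2, 3, 1] \<longleftrightarrow>
     (\<exists>i j k. i < j \<and> j < k \<and> k < length p \<and> p ! k < p ! i \<and> p ! i < p ! j)"
proof -
  have "(\<forall>r<3. \<forall>s<3. p ! ([i, j, k] ! r) < p ! ([i, j, k] ! s) \<longleftrightarrow>
          [2, 3, 1 :: nat] ! r < [2, 3, 1] ! s) \<longleftrightarrow> p ! k < p ! i \<and> p ! i < p ! j" for i j k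
    by (auto simp: all_less_3 dest: order.asym)
  then show ?thesis by (simp add: contains_pattern_3_iff)
qed

text \<open>
  The smaller and the larger entry to the right of a letter 2 may come in either order; the two
  orders are the two patterns.
\<close>
lemma avoids_213_231_iff_extremal:
  "\<not> contains_pattern p [2, 1, 3] \<and> \<not> contains_pattern p [2, 3, 1] \<longleftrightarrow> extremal p"
proof -
  have "contains_pattern p [2, 1, 3] \<or> contains_pattern p [2, 3, 1] \<longleftrightarrow>
      (\<exists>i j k. i < j \<and> i < k \<and> j < length p \<and> k < length p \<and> p ! j < p ! i \<and> p ! i < p ! k)"
    (is "_ \<longleftrightarrow> ?R")
  proof
    assume "contains_pattern p [2, 1, 3] \<or> contains_pattern p [2, 3, 1]"
    then show ?R
      unfolding contains_213_iff contains_231_iff by (meson order.strict_trans)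
  next
    assume ?R
    then obtain i j k where "i < j" "i < k" "j < length p" "k < length p"
      "p ! j < p ! i" "p ! i < p ! k" by blast
    moreover have "j < k \<or> k < j"
      using calculation by (metis linorder_neqE_nat order.asym)
    ultimately show "contains_pattern p [2, 1, 3] \<or> contains_pattern p [2, 3, 1]"
      unfolding contains_213_iff contains_231_iff by blast
  qed
  then show ?thesis unfolding extremal_iff_nth by blast
qed

section \<open>The simsun condition over an arbitrary alphabet\<close>

text \<open>
  Every threshold is allowed, not only those from 3 to the length: the length no longer
  bounds the letters.
\<close>
definition simsun_word :: "nat list \<Rightarrow> bool" where
  "simsun_word w \<longleftrightarrow> (\<forall>k. \<not> double_descent (filter (\<lambda>x. x \<le> k) w))"

lemma not_double_descent_short: "length w < 3 \<Longrightarrow> \<not> double_descent w"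
  by (simp add: double_descent_def)

lemma double_descent_Cons3:
  "double_descent (x # y # z # w) \<longleftrightarrow> x > y \<and> y > z \<or> double_descent (y # z # w)"
proof
  assume "double_descent (x # y # z # w)"
  then obtain i where i: "i + 2 < length (x # y # z # w)"
    "(x # y # z # w) ! i > (x # y # z # w) ! (i + 1)"
    "(x # y # z # w) ! (i + 1) > (x # y # z # w) ! (i + 2)"
    unfolding double_descent_def by blast
  show "x > y \<and> y > z \<or> double_descent (y # z # w)"
  proof (cases i)
    case 0
    with i show ?thesis by simp
  next
    case (Suc j)
    with i show ?thesis unfolding double_descent_def by (intro disjI2 exI[of _ j]) simp
  qed
next
  assume "x > y \<and> y > z \<or> double_descent (y # z # w)"
  then show "double_descent (x # y # z # w)"
  proof
    assume "x > y \<and> y > z"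
    then show ?thesis unfolding double_descent_def by (intro exI[of _ 0]) simp
  next
    assume "double_descent (y # z # w)"
    then obtain i where "i + 2 < length (y # z # w)"
      "(y # z # w) ! i > (y # z # w) ! (i + 1)" "(y # z # w) ! (i + 1) > (y # z # w) ! (i + 2)"
      unfolding double_descent_def by blast
    then show ?thesis unfolding double_descent_def by (intro exI[of _ "Suc i"]) simp
  qed
qed

lemma double_descent_Cons_min:
  assumes "\<forall>y\<in>set w. x < y"
  shows "double_descent (x # w) \<longleftrightarrow> double_descent w"
proof (cases "length w < 2")
  case True
  then show ?thesis by (simp add: not_double_descent_short)
next
  case False
  then obtain y z v where "w = y # z # v"
    by (metis One_nat_def length_0_conv length_Suc_conv less_2_cases_iff neq_Nil_conv)
  with assms show ?thesis by (auto simp: double_descent_Cons3)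
qed

lemma double_descent_Cons_Cons_min:
  assumes "\<forall>z\<in>set w. y < z"
  shows "double_descent (x # y # w) \<longleftrightarrow> double_descent w"
proof (cases w)
  case Nil
  then show ?thesis by (simp add: not_double_descent_short)
next
  case (Cons z v)
  with assms have "double_descent (x # y # w) \<longleftrightarrow> double_descent (y # w)"
    by (auto simp: double_descent_Cons3)
  with assms show ?thesis by (simp add: double_descent_Cons_min)
qed

lemma simsun_word_Cons_min:
  assumes "\<forall>y\<in>set w. x < y"
  shows "simsun_word (x # w) \<longleftrightarrow> simsun_word w"
proof -
  have "double_descent (filter (\<lambda>x. x \<le> k) (x # w)) \<longleftrightarrow> double_descent (filter (\<lambda>x. x \<le> k) w)" for k
    using assms double_descent_Cons_min[of "filter (\<lambda>x. x \<le> k) w" x] by simp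
  then show ?thesis by (simp add: simsun_word_def)
qed

lemma simsun_word_Cons_Cons_min:
  assumes "y < x" "\<forall>z\<in>set w. y < z"
  shows "simsun_word (x # y # w) \<longleftrightarrow> simsun_word w"
proof -
  have "double_descent (filter (\<lambda>x. x \<le> k) (x # y # w)) \<longleftrightarrow>
      double_descent (filter (\<lambda>x. x \<le> k) w)" for k
    \<comment> \<open>If \<open>x\<close> survives the filter then so does \<open>y\<close>, which keeps \<open>x\<close> apart from \<open>w\<close>.\<close>
    using assms double_descent_Cons_min[of "filter (\<lambda>x. x \<le> k) w" y]
      double_descent_Cons_Cons_min[of "filter (\<lambda>x. x \<le> k) w" y x] by simp
  then show ?thesis by (simp add: simsun_word_def)
qed

text \<open>
  The filter at threshold \<open>x\<close> removes nothing, so the word itself has no double descent.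
\<close>
lemma simsun_word_Cons_max:
  assumes "simsun_word (x # y # z # w)" "\<forall>u\<in>set (y # z # w). u < x"
  shows "y \<le> z"
proof -
  have "filter (\<lambda>u. u \<le> x) (x # y # z # w) = x # y # z # w"
    using assms(2) by (auto simp: less_imp_le)
  then have "\<not> double_descent (x # y # z # w)"
    using assms(1) unfolding simsun_word_def by metis
  then show ?thesis using assms(2) by (auto simp: double_descent_Cons3)
qed

text \<open>
  Thresholds below 3 leave too few letters for a double descent, and thresholds above \<open>n\<close>
  filter like \<open>n\<close> itself.
\<close>
lemma simsun_iff_simsun_word:
  assumes "p \<in> permutations_of_set {1..n}"
  shows "simsun p \<longleftrightarrow> simsun_word p"
proof -
  have p: "set p = {1..n}" "distinct p" "length p = n"
    using assms by (auto simp: permutations_of_set_def dest: distinct_card)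
  have filter_eq: "filter (\<lambda>x. x \<in> {1..k}) p = filter (\<lambda>x. x \<le> k) p" for k
    using p(1) by (intro filter_cong) auto
  have "double_descent (filter (\<lambda>x. x \<le> k) p) \<Longrightarrow> 3 \<le> k" for k
  proof (rule ccontr)
    assume dd: "double_descent (filter (\<lambda>x. x \<le> k) p)" and "\<not> 3 \<le> k"
    have "length (filter (\<lambda>x. x \<le> k) p) = card (set (filter (\<lambda>x. x \<le> k) p))"
      using p(2) by (metis distinct_card distinct_filter)
    also have "\<dots> \<le> card {1..k}"
      using p(1) by (intro card_mono) auto
    finally show False
      using dd \<open>\<not> 3 \<le> k\<close> not_double_descent_short by fastforce
  qed
  moreover have "filter (\<lambda>x. x \<le> k) p = filter (\<lambda>x. x \<le> n) p" if "n < k" for k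
    using p(1) that by (intro filter_cong) auto
  ultimately show ?thesis
    unfolding simsun_def simsun_word_def filter_eq p(3) by (metis le_refl not_le)
qed

section \<open>The Fibonacci recurrence\<close>

definition extremal_simsun :: "nat set \<Rightarrow> nat list set" where
  "extremal_simsun A = {w \<in> permutations_of_set A. extremal w \<and> simsun_word w}"

lemma RS_eq: "RS n [2, 1, 3] [2, 3, 1] = extremal_simsun {1..n}"
  unfolding RS_def extremal_simsun_def
  using avoids_213_231_iff_extremal simsun_iff_simsun_word by blast

lemma finite_extremal_simsun [simp]: "finite (extremal_simsun A)"
  unfolding extremal_simsun_def by simp

text \<open>
  A word of two or more letters starts with its minimum, or with its maximum followed by its
  minimum. After a maximum the next letter is a minimum or a maximum of the rest; if it were a
  maximum but not the only letter left, the first three letters would descend. When two letters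
  remain, the second case gives the decreasing word, with an empty rest.
\<close>
lemma extremal_simsun_split:
  assumes "finite A" "2 \<le> card A"
  defines "m \<equiv> Min A" and "M \<equiv> Max A"
  shows "extremal_simsun A =
    (\<lambda>w. m # w) ` extremal_simsun (A - {m}) \<union> (\<lambda>w. M # m # w) ` extremal_simsun (A - {M, m})"
    (is "_ = ?B \<union> ?C")
proof -
  have mM: "m \<in> A" "M \<in> A" "\<And>x. x \<in> A \<Longrightarrow> m \<le> x" "\<And>x. x \<in> A \<Longrightarrow> x \<le> M"
    using assms by (auto simp: m_def M_def intro: Min_in Max_in)
  have "m < M"
  proof (rule ccontr)
    assume "\<not> m < M"
    then have "A \<subseteq> {m}" using mM by fastforce
    then show False using assms(2) card_mono[of "{m}" A] by simp
  qed
  show ?thesis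
  proof (intro equalityI subsetI)
    fix w assume "w \<in> extremal_simsun A"
    then have w: "set w = A" "distinct w" "extremal w" "simsun_word w"
      by (auto simp: extremal_simsun_def permutations_of_set_def)
    then obtain x v where xv: "w = x # v" using mM(1) by (cases w) auto
    have v: "set v = A - {x}" "distinct v" using w xv by auto
    have "x = m \<or> x = M"
    proof (rule ccontr)
      assume "\<not> (x = m \<or> x = M)"
      then have "m \<in> set v" "M \<in> set v" "m < x" "x < M"
        using v mM w(1) xv by (auto simp: order_less_le)
      then show False using w(3) xv by auto
    qed
    then show "w \<in> ?B \<union> ?C"
    proof
      assume "x = m"
      then have "\<forall>y\<in>set v. x < y" using v mM by (auto simp: order_less_le)
      then have "v \<in> extremal_simsun (A - {m})"
        using w v xv \<open>x = m\<close> simsun_word_Cons_min[of v x]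
        by (auto simp: extremal_simsun_def permutations_of_set_def)
      then show ?thesis using xv \<open>x = m\<close> by blast
    next
      assume "x = M"
      then obtain y u where yu: "v = y # u" using v \<open>m < M\<close> mM(1) by (cases v) auto
      have u: "set u = A - {M, y}" "distinct u" "y \<in> A" "y \<noteq> M"
        using v yu \<open>x = M\<close> by auto
      have "y = m"
      proof (rule ccontr)
        assume "y \<noteq> m"
        then have "m \<in> set u" using u \<open>m < M\<close> mM(1) by auto
        then obtain z t where zt: "u = z # t" by (cases u) auto
        have "\<forall>a\<in>set (y # z # t). a < x"
          using v yu zt \<open>x = M\<close> mM(4) by (auto simp: order_less_le)
        then have "y \<le> z" using simsun_word_Cons_max w(4) xv yu zt by blast
        then have "y < z" using u zt v yu by (auto simp: order_less_le)
        \<comment> \<open>Then \<open>y\<close> is neither the minimum nor the maximum of the suffix that it starts.\<close>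
        moreover have "m < y" using \<open>y \<noteq> m\<close> mM(3) u(3) by (simp add: order_less_le)
        ultimately show False using w(3) xv yu zt \<open>m \<in> set u\<close> by auto
      qed
      then have "\<forall>z\<in>set u. m < z" using u mM(3) v yu by (auto simp: order_less_le)
      then have "simsun_word u"
        using w(4) xv yu \<open>x = M\<close> \<open>y = m\<close> \<open>m < M\<close> simsun_word_Cons_Cons_min[of m M u] by simp
      moreover have "extremal u" using w(3) xv yu by simp
      ultimately have "u \<in> extremal_simsun (A - {M, m})"
        using u(1,2) \<open>y = m\<close>
        by (simp add: extremal_simsun_def permutations_of_set_def)
      then show ?thesis using xv yu \<open>x = M\<close> \<open>y = m\<close> by blast
    qed
  next
    fix w assume "w \<in> ?B \<union> ?C"
    then show "w \<in> extremal_simsun A"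
    proof
      assume "w \<in> ?B"
      then obtain v where v: "w = m # v" "set v = A - {m}" "distinct v" "extremal v"
        "simsun_word v"
        by (auto simp: extremal_simsun_def permutations_of_set_def)
      then have less: "\<forall>y\<in>set v. m < y" using mM(3) by (auto simp: order_less_le)
      have "simsun_word w" using v less simsun_word_Cons_min by blast
      moreover have "extremal w" using v less by (auto dest: order.asym)
      ultimately show ?thesis using v mM(1)
        by (auto simp: extremal_simsun_def permutations_of_set_def)
    next
      assume "w \<in> ?C"
      then obtain v where v: "w = M # m # v" "set v = A - {M, m}" "distinct v" "extremal v"
        "simsun_word v"
        by (auto simp: extremal_simsun_def permutations_of_set_def)
      then have less: "\<forall>y\<in>set v. m < y \<and> y < M" using mM(3,4) by (auto simp: order_less_le)
      have "simsun_word w" using v less \<open>m < M\<close> simsun_word_Cons_Cons_min by blast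
      moreover have "extremal w" using v less \<open>m < M\<close> by (auto dest: order.asym)
      ultimately show ?thesis using v mM(1,2) \<open>m < M\<close>
        by (auto simp: extremal_simsun_def permutations_of_set_def)
    qed
  qed
qed

lemma card_extremal_simsun:
  assumes "finite A" "card A = n"
  shows "card (extremal_simsun A) = fib (n + 1)"
  using assms
proof (induction n arbitrary: A rule: fib.induct)
  case 1
  then have "A = {}" by simp
  then have "extremal_simsun A = {w \<in> {[]}. extremal w \<and> simsun_word w}"
    by (simp add: extremal_simsun_def)
  also have "\<dots> = {[]}"
    by (auto simp: simsun_word_def not_double_descent_short)
  finally have "extremal_simsun A = {[]}" .
  then show ?case by simp
next
  case 2
  then obtain a where "A = {a}" by (metis One_nat_def card_1_singletonE)
  then have "extremal_simsun A = {w \<in> {[a]}. extremal w \<and> simsun_word w}"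
    by (simp add: extremal_simsun_def)
  also have "\<dots> = {[a]}"
    by (auto simp: simsun_word_def not_double_descent_short)
  finally have "extremal_simsun A = {[a]}" .
  then show ?case by simp
next
  case (3 n)
  define m M where "m = Min A" and "M = Max A"
  have "A \<noteq> {}" using 3(4) by auto
  then have in_A: "m \<in> A" "M \<in> A" using 3(3) by (simp_all add: m_def M_def)
  have "m \<noteq> M"
  proof
    assume "m = M"
    then have "A \<subseteq> {m}" using 3(3) by (metis Max_ge Min_le M_def antisym insertI1 m_def subsetI)
    then show False using 3(4) card_mono[of "{m}" A] by simp
  qed
  have "card (A - {m}) = Suc n" "card (A - {M, m}) = n"
    using 3(3,4) in_A \<open>m \<noteq> M\<close> by (simp_all add: card_Diff_subset)
  then have IH: "card (extremal_simsun (A - {m})) = fib (Suc n + 1)"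
    "card (extremal_simsun (A - {M, m})) = fib (n + 1)"
    using 3(1)[of "A - {m}"] 3(2)[of "A - {M, m}"] 3(3) by simp_all
  have "extremal_simsun A =
      (\<lambda>w. m # w) ` extremal_simsun (A - {m}) \<union> (\<lambda>w. M # m # w) ` extremal_simsun (A - {M, m})"
    using extremal_simsun_split[of A] 3(3,4) by (simp add: m_def M_def)
  also have "card \<dots> = card ((\<lambda>w. m # w) ` extremal_simsun (A - {m})) +
      card ((\<lambda>w. M # m # w) ` extremal_simsun (A - {M, m}))"
    using \<open>m \<noteq> M\<close> by (intro card_Un_disjoint) auto
  also have "\<dots> = fib (Suc n + 1) + fib (n + 1)"
    using IH by (simp add: card_image inj_on_def)
  finally show ?case by simp
qed

theorem lemma7p6:
  fixes n :: nat
  shows "card (RS n [2, 1, 3] [2, 3, 1]) = fib (n + 1)"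
  by (simp only: RS_eq card_extremal_simsun finite_atLeastAtMost card_atLeastAtMost diff_Suc_1)

end
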